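(* Let $Q=(q_{ij})\in\mathbb{R}^{n\times m}$, $\pi\in\mathbb{R}^m$ with $\pi>0$, $\sigma\in\mathbb{R}^n$ with $\sigma>0$, and $w>0$. Consider the primal problem (P) of maximizing $U(x)=\min_{1\le i\le n}\frac{(Qx)^{(i)}}{\sigma^{(i)}}$ over $\{x\in\mathbb{R}^m \mid x\ge0,\ \langle\pi,x\rangle=w\}$ and the dual problem (D) of minimizing $\Phi(\lambda)=w\max_{1\le j\le m}\frac{(Q^T\lambda)^{(j)}}{\pi^{(j)}}$ over $\{\lambda\in\mathbb{R}^n\mid\lambda\ge0,\ \langle\sigma,\lambda\rangle=1\}$. Let $(x_k)_{k\ge0}$ and $(\lambda_k)_{k\ge 0}$ be the demands and internal prices generated by the consumption cycle (the dual averaging scheme described in the context, with discrete choice prox-function $d=E^*-E^*(p_0)$, where $E^*$ is $\beta$-strongly convex with respect to $\|\cdot\|_1$), and let $$\bar x_k=\frac{1}{k+1}\sum_{\ell=0}^{k}x_\ell,\qquad \bar\lambda_k=\frac{1}{k+1}\sum_{\ell=0}^{k}\lambda_\ell .$$ Then the duality gap between (P) and (D) evaluated at the average demand and the average internal prices closes at the rate $O\left(\frac{1}{\sqrt{k+1}}\right)$; namely, for all $k\ge0$, $$0\le\Phi(\bar\lambda_k)-U(\bar x_k)\le\left(D+\frac{M^2}{\beta}\right)\frac{1}{\sqrt{k+1}},$$ where $$M=w\max_{1\le i\le n,\ 1\le j\le m}\frac{|q_{ij}|}{\sigma^{(i)}\pi^{(j)}},\qquad D=\mathbb{E}_\epsilon\left(\max_{1\le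 i\le n}\epsilon^{(i)}\right)-\min_{1\le i\le n}\mathbb{E}_\epsilon\left(\epsilon^{(i)}\right).$$
   Context: Division of vectors is componentwise. Random utility model: $\epsilon=(\epsilon^{(1)},\ldots,\epsilon^{(n)})^T$ is a random vector in $\mathbb{R}^n$ with finite mean whose distribution is absolutely continuous with respect to the Lebesgue measure and fully supported on $\mathbb{R}^n$. Its surplus function is $E(u)=\mathbb{E}_\epsilon\left(\max_{1\le i\le n}(u^{(i)}+\epsilon^{(i)})\right)$, with convex conjugate $E^*(p)=\sup_{u\in\mathbb{R}^n}(\langle p,u\rangle-E(u))$, which is finite exactly on the simplex $\Delta=\{p\in\mathbb{R}^n\mid\sum_i p^{(i)}=1,\ p^{(i)}\ge0\}$. It is assumed that $E^*$ is $\beta$-strongly convex with respect to $\|x\|_1=\sum_i|x^{(i)}|$ for some $\beta>0$, i.e. $E^*(\alpha p+(1-\alpha)q)\le\alpha E^*(p)+(1-\alpha)E^*(q)-\frac{\beta}{2}\alpha(1-\alpha)\|p-q\|_1^2$ for all $p,q\in\Delta$, $\alpha\in[0,1]$. Let $p_0$ be the unique minimizer of $E^*$ over $\Delta$ and $d(p)=E^*(p)-E^*(p_0)$. Standing assumption on the consumption problem: there exists a demand vector $x\ge0$ with $\langle\pi,x\rangle\le w$ and $\min_{i}\frac{(Qx)^{(i)}}{\sigma^{(i)}}>0$. Consumption cycle (dual averaging scheme): start with $p_0$. For $k=0,1,2,\ldots$: 1. Set the internal prices $\lambda_k=\frac{p_k}{\sigma}$ (componentwise). Let $J(\lambda_k)$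 be the set of indices $j\in\{1,\ldots,m\}$ attaining $\max_{1\le j\le m}\frac{(Q^T\lambda_k)^{(j)}}{\pi^{(j)}}$. Choose any sharing vector $y_k\in\mathbb{R}^m$ with $y_k\ge0$, $\sum_{j=1}^m y_k^{(j)}=1$ and $y_k^{(j)}=0$ for $j\notin J(\lambda_k)$, and set the demand $x_k=w\frac{y_k}{\pi}$ (componentwise). Then $\frac{Qx_k}{\sigma}$ is a subgradient at $p_k$ of the function $\Psi(p)=\Phi\left(\frac{p}{\sigma}\right)$. 2. Set $s_{k+1}=\frac{1}{k+1}\sum_{\ell=0}^{k}\frac{Qx_\ell}{\sigma}$. 3. Set $p_{k+1}=\arg\min_{p\in\Delta}\left\{\langle s_{k+1},p\rangle+\frac{d(p)}{\sqrt{k+1}}\right\}$. *)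

theory Defs
  imports "HOL-Probability.Probability" "HOL-Library.Landau_Symbols"
begin

definition vdiv :: "real ^ 'n \<Rightarrow> real ^ 'n \<Rightarrow> real ^ 'n" where
  "vdiv x y = (\<chi> i. x $ i / y $ i)"

definition l1norm :: "real ^ 'n::finite \<Rightarrow> real" where
  "l1norm x = (\<Sum>i\<in>UNIV. \<bar>x $ i\<bar>)"

definition prob_simplex :: "(real ^ 'n::finite) set" where
  "prob_simplex = {p. (\<Sum>i\<in>UNIV. p $ i) = 1 \<and> (\<forall>i. 0 \<le> p $ i)}"

definition average :: "(nat \<Rightarrow> 'v::real_vector) \<Rightarrow> nat \<Rightarrow> 'v" where
  "average f k = (1 / real (k + 1)) *\<^sub>R (\<Sum>l\<le>k. f l)"

definition random_utility :: "'a measure \<Rightarrow> ('a \<Rightarrow> real ^ 'n::finite) \<Rightarrow> bool" where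
  "random_utility P \<epsilon> \<longleftrightarrow>
     prob_space P \<and>
     \<epsilon> \<in> borel_measurable P \<and>
     integrable P \<epsilon> \<and>
     absolutely_continuous lborel (distr P borel \<epsilon>) \<and>
     (\<forall>S. open S \<longrightarrow> S \<noteq> {} \<longrightarrow> 0 < measure (distr P borel \<epsilon>) S)"

definition surplus :: "'a measure \<Rightarrow> ('a \<Rightarrow> real ^ 'n::finite) \<Rightarrow> real ^ 'n \<Rightarrow> real" where
  "surplus P \<epsilon> u = (LINT \<omega>|P. (MAX i. u $ i + \<epsilon> \<omega> $ i))"

definition surplus_conj :: "'a measure \<Rightarrow> ('a \<Rightarrow> real ^ 'n::finite) \<Rightarrow> real ^ 'n \<Rightarrow> ereal" where
  "surplus_conj P \<epsilon> p = (SUP u. ereal (p \<bullet> u - surplus P \<epsilon> u))"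

definition l1_strongly_convex_on ::
    "(real ^ 'n::finite) set \<Rightarrow> real \<Rightarrow> (real ^ 'n \<Rightarrow> ereal) \<Rightarrow> bool" where
  "l1_strongly_convex_on S \<beta> f \<longleftrightarrow>
     (\<forall>p\<in>S. \<forall>q\<in>S. \<forall>\<alpha>\<in>{0..1}.
        f (\<alpha> *\<^sub>R p + (1 - \<alpha>) *\<^sub>R q)
          \<le> ereal \<alpha> * f p + ereal (1 - \<alpha>) * f q
             - ereal (\<beta> / 2 * \<alpha> * (1 - \<alpha>) * (l1norm (p - q))\<^sup>2))"

definition primal_feasible :: "real ^ 'm \<Rightarrow> real \<Rightarrow> (real ^ 'm::finite) set" where
  "primal_feasible \<pi> w = {x. (\<forall>j. 0 \<le> x $ j) \<and> \<pi> \<bullet> x = w}"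

definition primal_obj :: "real ^ 'm ^ 'n \<Rightarrow> real ^ 'n \<Rightarrow> real ^ 'm::finite \<Rightarrow> real" where
  "primal_obj Q \<sigma> x = (MIN i. (Q *v x) $ i / \<sigma> $ i)"

definition dual_feasible :: "real ^ 'n \<Rightarrow> (real ^ 'n::finite) set" where
  "dual_feasible \<sigma> = {l. (\<forall>i. 0 \<le> l $ i) \<and> \<sigma> \<bullet> l = 1}"

definition dual_obj :: "real ^ 'm ^ 'n \<Rightarrow> real ^ 'm \<Rightarrow> real \<Rightarrow> real ^ 'n::finite \<Rightarrow> real" where
  "dual_obj Q \<pi> w l = w * (MAX j. (transpose Q *v l) $ j / \<pi> $ j)"

definition best_goods :: "real ^ 'm ^ 'n \<Rightarrow> real ^ 'm \<Rightarrow> real ^ 'n::finite \<Rightarrow> 'm::finite set" where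
  "best_goods Q \<pi> l =
     {j. (transpose Q *v l) $ j / \<pi> $ j = (MAX j'. (transpose Q *v l) $ j' / \<pi> $ j')}"

text \<open>The prox-function is \<open>d q = F q - F (p 0)\<close>, where \<open>F\<close> stands for the conjugate
  of the surplus function.  The minimisers of \<open>F\<close> and of each subproblem
  are unique when \<open>F\<close> is strongly convex, so it suffices to say that \<open>p 0\<close> and
  \<open>p (Suc k)\<close> are minimisers.  The sharing vectors \<open>y k\<close> are arbitrary subject to the stated
  constraints.\<close>

definition consumption_cycle ::
    "(real ^ 'n \<Rightarrow> ereal) \<Rightarrow> real ^ 'm ^ 'n \<Rightarrow> real ^ 'm \<Rightarrow> real ^ 'n \<Rightarrow> real \<Rightarrow>
     (nat \<Rightarrow> real ^ 'n::finite) \<Rightarrow> (nat \<Rightarrow> real ^ 'n) \<Rightarrow> (nat \<Rightarrow> real ^ 'm::finite) \<Rightarrow>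
     (nat \<Rightarrow> real ^ 'm) \<Rightarrow> bool" where
  "consumption_cycle F Q \<pi> \<sigma> w p lam y x \<longleftrightarrow>
     is_arg_min F (\<lambda>q. q \<in> prob_simplex) (p 0) \<and>
     (\<forall>k. lam k = vdiv (p k) \<sigma> \<and>
          (\<forall>j. 0 \<le> y k $ j) \<and> (\<Sum>j\<in>UNIV. y k $ j) = 1 \<and>
          (\<forall>j. j \<notin> best_goods Q \<pi> (lam k) \<longrightarrow> y k $ j = 0) \<and>
          x k = w *\<^sub>R vdiv (y k) \<pi> \<and>
          is_arg_min
            (\<lambda>q. ereal (average (\<lambda>l. vdiv (Q *v x l) \<sigma>) k \<bullet> q)
                   + (F q - F (p 0)) / ereal (sqrt (real (k + 1))))
            (\<lambda>q. q \<in> prob_simplex) (p (Suc k)))"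

definition gap_M :: "real ^ 'm ^ 'n \<Rightarrow> real ^ 'm::finite \<Rightarrow> real ^ 'n::finite \<Rightarrow> real \<Rightarrow> real" where
  "gap_M Q \<pi> \<sigma> w = w * (MAX (i, j). \<bar>Q $ i $ j\<bar> / (\<sigma> $ i * \<pi> $ j))"

definition gap_D :: "'a measure \<Rightarrow> ('a \<Rightarrow> real ^ 'n::finite) \<Rightarrow> real" where
  "gap_D P \<epsilon> = (LINT \<omega>|P. (MAX i. \<epsilon> \<omega> $ i)) - (MIN i. (LINT \<omega>|P. \<epsilon> \<omega> $ i))"

end

theory Submission
  imports Defs
begin

text \<open>
  Write \<open>g l\<close> for the vector \<open>Q x\<^sub>l / \<sigma>\<close> and \<open>f\<close> for the conjugate of the surplus function on the
  simplex, so that the prox-function is \<open>f - f (p 0)\<close>.  Since \<open>x l\<close> spends the budget on the best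
  goods at the prices \<open>lam l\<close>, the dual objective at \<open>lam l\<close> equals \<open>g l \<bullet> p l\<close>
  (\<open>inner_best_demand\<close>), and by convexity the dual objective at the average prices is at most
  the average of these numbers.  On the other hand, the primal objective at the average demand
  is the smallest component of the average of the \<open>g l\<close>, that is, its inner product with a
  vertex of the simplex.  The duality gap is therefore at most the average regret of dual
  averaging against that vertex.

  The regret is bounded by following the minimal value of the regularized linear model
  (\<open>dual_averaging_regret\<close>): strong convexity gives quadratic growth at each minimizer \<open>p k\<close>,
  which pays for the change of the model up to \<open>M\<^sup>2 / (2 * \<beta> * sqrt k)\<close>, or \<open>M\<^sup>2 / (2 * \<beta>)\<close>
  in the step from \<open>k = 0\<close>, where \<open>M\<close> bounds the components of \<open>g k\<close>
  (\<open>abs_vdiv_demand_le_gap_M\<close>).  The sum of these errors over the first \<open>k + 1\<close> steps is at most \<open>M\<^sup>2 / \<beta> * sqrt (k + 1)\<close>.  The remaining term is the prox-function at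
  the vertex, which \<open>prox_vertex_le_gap_D\<close> bounds by estimating the surplus function from below
  by the mean of a single component, and its conjugate from below by its term at zero.
  Nonnegativity of the gap is weak duality for the feasible averages
  (\<open>weak_duality\<close>).
\<close>

section \<open>The one-norm, the simplex and averages\<close>

lemma inner_vec_sum: "(u::real ^ 'n::finite) \<bullet> v = (\<Sum>i\<in>UNIV. u $ i * v $ i)"
  by (simp add: inner_vec_def)

lemma abs_inner_le_l1norm:
  fixes g h :: "real ^ 'n::finite"
  assumes "\<And>i. \<bar>g $ i\<bar> \<le> M"
  shows "\<bar>g \<bullet> h\<bar> \<le> M * l1norm h"
proof -
  have "\<bar>g \<bullet> h\<bar> \<le> (\<Sum>i\<in>UNIV. \<bar>g $ i * h $ i\<bar>)"
    unfolding inner_vec_sum by (rule sum_abs)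
  also have "\<dots> \<le> (\<Sum>i\<in>UNIV. M * \<bar>h $ i\<bar>)"
    by (rule sum_mono) (simp add: abs_mult mult_right_mono assms)
  finally show ?thesis by (simp add: l1norm_def sum_distrib_left)
qed

lemma convex_prob_simplex: "convex (prob_simplex :: (real ^ 'n::finite) set)"
  unfolding convex_def prob_simplex_def
  by (auto simp: sum.distrib simp flip: sum_distrib_left)

lemma axis_in_prob_simplex: "axis i 1 \<in> (prob_simplex :: (real ^ 'n::finite) set)"
  by (auto simp: prob_simplex_def axis_def)

lemma average_eq_sum_lessThan: "average f k = (1 / real (k + 1)) *\<^sub>R (\<Sum>l<Suc k. f l)"
  by (simp add: average_def lessThan_Suc_atMost)

lemma average_mem_convex:
  assumes "convex S" "\<And>l. f l \<in> S"
  shows "average f k \<in> S"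
proof -
  have "(\<Sum>l\<le>k. (1 / real (k + 1)) *\<^sub>R f l) \<in> S"
    by (rule convex_sum) (auto simp: assms)
  then show ?thesis by (simp add: average_def scaleR_sum_right)
qed

section \<open>Dual averaging\<close>

text \<open>A minimizer of a strongly convex function is a point of quadratic growth; here \<open>c\<close>
  stands for half the modulus times the squared distance from \<open>z\<close> to \<open>q\<close>.\<close>

lemma strongly_convex_growth_at_minimizer:
  fixes h :: "'v::real_vector \<Rightarrow> real"
  assumes conv: "convex S" and "z \<in> S" "q \<in> S"
    and min: "\<And>v. v \<in> S \<Longrightarrow> h z \<le> h v"
    and sc: "\<And>\<alpha>. 0 \<le> \<alpha> \<Longrightarrow> \<alpha> \<le> 1 \<Longrightarrow>
      h (\<alpha> *\<^sub>R q + (1 - \<alpha>) *\<^sub>R z) \<le> \<alpha> * h q + (1 - \<alpha>) * h z - \<alpha> * (1 - \<alpha>) * c"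
  shows "h z + c \<le> h q"
proof -
  have "h z + (1 - \<alpha>) * c \<le> h q" if "0 < \<alpha>" "\<alpha> < 1" for \<alpha>
  proof -
    have "\<alpha> *\<^sub>R q + (1 - \<alpha>) *\<^sub>R z \<in> S"
      using conv \<open>z \<in> S\<close> \<open>q \<in> S\<close> that by (intro convexD) auto
    then have "h z \<le> \<alpha> * h q + (1 - \<alpha>) * h z - \<alpha> * (1 - \<alpha>) * c"
      using min sc[of \<alpha>] that by fastforce
    then have "\<alpha> * (h z + (1 - \<alpha>) * c) \<le> \<alpha> * h q"
      by (simp add: algebra_simps)
    then show ?thesis using that by simp
  qed
  then have "\<forall>\<^sub>F \<alpha> in at_right 0. h z + (1 - \<alpha>) * c \<le> h q"
    unfolding eventually_at_right_field by (intro exI[of _ 1]) auto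
  moreover have "((\<lambda>\<alpha>. h z + (1 - \<alpha>) * c) \<longlongrightarrow> h z + (1 - 0) * c) (at_right 0)"
    by (intro tendsto_intros)
  ultimately show ?thesis
    by (auto dest: tendsto_upperbound)
qed

text \<open>The regret bound of dual averaging, for arbitrary nondecreasing weights \<open>\<gamma>\<close>.  The minimal
  value of the regularized model \<open>(\<Sum>l<k. g l) \<bullet> q + \<gamma> k * (f q - f (p 0))\<close>, called \<open>V k\<close> in the
  proof, gains at least \<open>g k \<bullet> p k - M\<^sup>2 / (2 * \<beta> * \<gamma> k)\<close> in each step, by the quadratic
  growth of the model at its minimizer \<open>p k\<close>.\<close>

lemma dual_averaging_regret:
  fixes f :: "real ^ 'n::finite \<Rightarrow> real" and g p :: "nat \<Rightarrow> real ^ 'n"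
  assumes conv: "convex S"
    and beta: "0 < \<beta>"
    and sc: "l1_strongly_convex_on S \<beta> (\<lambda>q. ereal (f q))"
    and gamma_pos: "\<And>k. 0 < \<gamma> k" and gamma_mono: "\<And>k. \<gamma> k \<le> \<gamma> (Suc k)"
    and mem: "\<And>k. p k \<in> S"
    and min: "\<And>k q. q \<in> S \<Longrightarrow>
      (\<Sum>l<k. g l) \<bullet> p k + \<gamma> k * f (p k) \<le> (\<Sum>l<k. g l) \<bullet> q + \<gamma> k * f q"
    and bound: "\<And>k i. \<bar>g k $ i\<bar> \<le> M"
    and q: "q \<in> S"
  shows "(\<Sum>l<k. g l \<bullet> p l)
    \<le> (\<Sum>l<k. g l) \<bullet> q + \<gamma> k * (f q - f (p 0)) + M\<^sup>2 / (2 * \<beta>) * (\<Sum>l<k. 1 / \<gamma> l)"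
proof -
  define G where "G k = (\<Sum>l<k. g l)" for k
  define V where "V k = G k \<bullet> p k + \<gamma> k * (f (p k) - f (p 0))" for k
  have G_Suc: "G (Suc k) = G k + g k" for k by (simp add: G_def)
  have f_min: "f (p 0) \<le> f v" if "v \<in> S" for v
    using min[of v 0] that gamma_pos[of 0] by simp
  have step: "V k + g k \<bullet> p k - M\<^sup>2 / (2 * \<beta>) * (1 / \<gamma> k) \<le> V (Suc k)" for k
  proof -
    define r where "r = l1norm (p (Suc k) - p k)"
    define h where "h v = G k \<bullet> v + \<gamma> k * f v" for v
    have "h (p k) + \<gamma> k * \<beta> / 2 * r\<^sup>2 \<le> h (p (Suc k))"
    proof (rule strongly_convex_growth_at_minimizer[OF conv mem mem])
      show "h (p k) \<le> h v" if "v \<in> S" for v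
        using min[OF that] by (simp add: h_def G_def)
      fix \<alpha> :: real assume a: "0 \<le> \<alpha>" "\<alpha> \<le> 1"
      let ?z = "\<alpha> *\<^sub>R p (Suc k) + (1 - \<alpha>) *\<^sub>R p k"
      have "f ?z \<le> \<alpha> * f (p (Suc k)) + (1 - \<alpha>) * f (p k) - \<beta> / 2 * \<alpha> * (1 - \<alpha>) * r\<^sup>2"
        using sc mem a unfolding l1_strongly_convex_on_def r_def by fastforce
      then have "\<gamma> k * f ?z
          \<le> \<gamma> k * (\<alpha> * f (p (Suc k)) + (1 - \<alpha>) * f (p k) - \<beta> / 2 * \<alpha> * (1 - \<alpha>) * r\<^sup>2)"
        using gamma_pos[of k] by (intro mult_left_mono) auto
      moreover have "G k \<bullet> ?z = \<alpha> * (G k \<bullet> p (Suc k)) + (1 - \<alpha>) * (G k \<bullet> p k)"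
        by (simp add: inner_right_distrib)
      ultimately show "h ?z \<le> \<alpha> * h (p (Suc k)) + (1 - \<alpha>) * h (p k)
          - \<alpha> * (1 - \<alpha>) * (\<gamma> k * \<beta> / 2 * r\<^sup>2)"
        unfolding h_def by (simp add: algebra_simps)
    qed
    moreover have "\<gamma> k * (f (p (Suc k)) - f (p 0)) \<le> \<gamma> (Suc k) * (f (p (Suc k)) - f (p 0))"
      using gamma_mono f_min[OF mem] by (intro mult_right_mono) auto
    moreover have "g k \<bullet> p k - M * r \<le> g k \<bullet> p (Suc k)"
      using abs_inner_le_l1norm[of "g k" M "p (Suc k) - p k", OF bound]
      by (simp add: r_def inner_diff_right)
    \<comment> \<open>Young's inequality absorbs the linear loss into the quadratic growth.\<close>
    moreover have "M * r \<le> \<gamma> k * \<beta> / 2 * r\<^sup>2 + M\<^sup>2 / (2 * \<beta>) * (1 / \<gamma> k)"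
    proof -
      have "0 \<le> (\<gamma> k * \<beta> * r - M)\<^sup>2 / (2 * \<beta> * \<gamma> k)"
        using beta gamma_pos[of k] by simp
      also have "\<dots> = \<gamma> k * \<beta> / 2 * r\<^sup>2 + M\<^sup>2 / (2 * \<beta>) * (1 / \<gamma> k) - M * r"
        using beta gamma_pos[of k] by (simp add: field_simps power2_eq_square)
      finally show ?thesis by simp
    qed
    ultimately show ?thesis
      unfolding V_def h_def G_Suc by (simp add: algebra_simps)
  qed
  have "(\<Sum>l<k. g l \<bullet> p l) - M\<^sup>2 / (2 * \<beta>) * (\<Sum>l<k. 1 / \<gamma> l) \<le> V k"
  proof (induction k)
    case 0
    then show ?case by (simp add: V_def G_def)
  next
    case (Suc k)
    then show ?case using step[of k] by (simp only: sum.lessThan_Suc distrib_left)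
  qed
  also have "V k \<le> G k \<bullet> q + \<gamma> k * (f q - f (p 0))"
    using min[OF q, of k] by (simp add: V_def G_def algebra_simps)
  finally show ?thesis by (simp add: G_def)
qed

lemma sum_inverse_sqrt_le:
  "(\<Sum>l<Suc k. 1 / max 1 (sqrt (real l))) \<le> 2 * sqrt (real (Suc k))"
proof (cases "k = 0")
  case False
  then have "1 \<le> k" by simp
  then have "(\<Sum>l<Suc k. 1 / max 1 (sqrt (real l))) \<le> 2 * sqrt (real k)"
  proof (induction k rule: nat_induct_at_least)
    case base
    then show ?case by simp
  next
    case (Suc k)
    define a b where "a = sqrt (real k)" and "b = sqrt (real (Suc k))"
    have ab: "a\<^sup>2 + 1 = b\<^sup>2" "1 \<le> b" "a \<ge> 0" by (auto simp: a_def b_def)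
    have "0 \<le> (b - a)\<^sup>2" by simp
    then have "1 \<le> 2 * (b - a) * b"
      using ab by (simp add: power2_eq_square algebra_simps)
    then have "1 / b \<le> 2 * (b - a)" using ab by (simp add: field_simps)
    moreover have "max 1 (sqrt (real (Suc k))) = b" using ab by (simp add: b_def)
    ultimately show ?case
      using Suc.IH by (subst sum.lessThan_Suc) (simp add: a_def b_def del: of_nat_Suc)
  qed
  also have "\<dots> \<le> 2 * sqrt (real (Suc k))" by simp
  finally show ?thesis .
qed simp

text \<open>The regret bound for the weights \<open>sqrt k\<close>, divided by the number of steps.\<close>

lemma dual_averaging_sqrt_rate:
  fixes f :: "real ^ 'n::finite \<Rightarrow> real" and g p :: "nat \<Rightarrow> real ^ 'n"
  assumes conv: "convex S"
    and beta: "0 < \<beta>"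
    and sc: "l1_strongly_convex_on S \<beta> (\<lambda>q. ereal (f q))"
    and mem: "\<And>k. p k \<in> S"
    and min0: "\<And>q. q \<in> S \<Longrightarrow> f (p 0) \<le> f q"
    and min: "\<And>k q. q \<in> S \<Longrightarrow>
      average g k \<bullet> p (Suc k) + (f (p (Suc k)) - f (p 0)) / sqrt (real (k + 1))
      \<le> average g k \<bullet> q + (f q - f (p 0)) / sqrt (real (k + 1))"
    and bound: "\<And>k i. \<bar>g k $ i\<bar> \<le> M"
    and q: "q \<in> S"
  shows "average (\<lambda>l. g l \<bullet> p l) k
    \<le> average g k \<bullet> q + (f q - f (p 0) + M\<^sup>2 / \<beta>) * (1 / sqrt (real (k + 1)))"
proof -
  \<comment> \<open>The scheme prescribes the weight \<open>sqrt k\<close> for \<open>k \<ge> 1\<close>.  As \<open>p 0\<close> minimizes \<open>f\<close> alone,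
    the weight at \<open>0\<close> is free; the value \<open>1\<close> is positive and keeps the weights nondecreasing.\<close>
  define \<gamma> where "\<gamma> k = max 1 (sqrt (real k))" for k
  have gamma_Suc: "\<gamma> (Suc k) = sqrt (real (Suc k))" for k
    by (simp add: \<gamma>_def)
  have "(\<Sum>l<k. g l) \<bullet> p k + \<gamma> k * f (p k) \<le> (\<Sum>l<k. g l) \<bullet> v + \<gamma> k * f v" if "v \<in> S" for k v
  proof (cases k)
    case 0
    then show ?thesis using min0[OF that] by (simp add: \<gamma>_def)
  next
    case (Suc j)
    define N s where "N = real (Suc j)" and "s = sqrt N"
    have N: "0 < N" and s: "0 < s" "N = s * s" by (auto simp: N_def s_def)
    let ?G = "\<Sum>l<Suc j. g l"
    have scale: "N * (average g j \<bullet> u + (f u - f (p 0)) / s) = ?G \<bullet> u + s * f u - s * f (p 0)" for u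
    proof -
      have "N * (average g j \<bullet> u) = ?G \<bullet> u"
        using N by (simp add: average_eq_sum_lessThan N_def del: sum.lessThan_Suc)
      moreover have "N * ((f u - f (p 0)) / s) = s * f u - s * f (p 0)"
        using s by (simp add: field_simps)
      ultimately show ?thesis by (simp only: distrib_left)
    qed
    have "N * (average g j \<bullet> p (Suc j) + (f (p (Suc j)) - f (p 0)) / s)
        \<le> N * (average g j \<bullet> v + (f v - f (p 0)) / s)"
      using min[OF that, of j] N by (intro mult_left_mono) (simp_all add: s_def N_def add.commute)
    then have "?G \<bullet> p (Suc j) + s * f (p (Suc j)) \<le> ?G \<bullet> v + s * f v"
      unfolding scale by simp
    then show ?thesis unfolding Suc gamma_Suc s_def N_def .
  qed
  then have "(\<Sum>l<Suc k. g l \<bullet> p l) \<le> (\<Sum>l<Suc k. g l) \<bullet> q + \<gamma> (Suc k) * (f q - f (p 0))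
      + M\<^sup>2 / (2 * \<beta>) * (\<Sum>l<Suc k. 1 / \<gamma> l)"
    by (intro dual_averaging_regret[OF conv beta sc _ _ mem _ bound q])
      (auto simp: \<gamma>_def max_def)
  also have "M\<^sup>2 / (2 * \<beta>) * (\<Sum>l<Suc k. 1 / \<gamma> l) \<le> M\<^sup>2 / (2 * \<beta>) * (2 * sqrt (real (Suc k)))"
    unfolding \<gamma>_def using beta by (intro mult_left_mono sum_inverse_sqrt_le) auto
  finally have *: "(\<Sum>l<Suc k. g l \<bullet> p l)
      \<le> (\<Sum>l<Suc k. g l) \<bullet> q + (f q - f (p 0) + M\<^sup>2 / \<beta>) * sqrt (real (Suc k))"
    unfolding gamma_Suc by (simp add: algebra_simps del: of_nat_Suc sum.lessThan_Suc)
  define s where "s = sqrt (real (Suc k))"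
  have s: "0 < s" "real (k + 1) = s * s" by (auto simp: s_def)
  have "(1 / (s * s)) * (\<Sum>l<Suc k. g l \<bullet> p l)
      \<le> (1 / (s * s)) * ((\<Sum>l<Suc k. g l) \<bullet> q + (f q - f (p 0) + M\<^sup>2 / \<beta>) * s)"
    using * s unfolding s_def[symmetric] by (intro mult_left_mono) auto
  also have "\<dots> = (1 / (s * s)) * ((\<Sum>l<Suc k. g l) \<bullet> q) + (f q - f (p 0) + M\<^sup>2 / \<beta>) * (1 / s)"
    using s(1) by (simp add: distrib_left del: sum.lessThan_Suc)
  finally show ?thesis
    unfolding average_eq_sum_lessThan s(2) using s(1)
    by (simp del: sum.lessThan_Suc)
qed

section \<open>The conjugate of the surplus function on the simplex\<close>

lemma integrable_Max:
  fixes X :: "'i \<Rightarrow> 'a \<Rightarrow> real"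
  assumes "finite I" "I \<noteq> {}" "\<And>i. i \<in> I \<Longrightarrow> integrable M (X i)"
  shows "integrable M (\<lambda>\<omega>. MAX i\<in>I. X i \<omega>)"
  using assms by (induction I rule: finite_ne_induct) auto

context
  fixes P :: "'a measure" and \<epsilon> :: "'a \<Rightarrow> real ^ 'n::finite"
  assumes rum: "random_utility P \<epsilon>"
begin

lemma integrable_component: "integrable P (\<lambda>\<omega>. \<epsilon> \<omega> $ i)"
  using rum integrable_bounded_linear[OF bounded_linear_vec_nth]
  unfolding random_utility_def by blast

lemma integrable_shifted_Max: "integrable P (\<lambda>\<omega>. MAX i. u $ i + \<epsilon> \<omega> $ i)"
proof -
  interpret prob_space P using rum by (simp add: random_utility_def)
  show ?thesis by (rule integrable_Max) (auto intro: integrable_component)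
qed

lemma surplus_ge: "u $ i + (LINT \<omega>|P. \<epsilon> \<omega> $ i) \<le> surplus P \<epsilon> u"
proof -
  interpret prob_space P using rum by (simp add: random_utility_def)
  have "(LINT \<omega>|P. u $ i + \<epsilon> \<omega> $ i) \<le> surplus P \<epsilon> u"
    unfolding surplus_def
    by (intro integral_mono integrable_shifted_Max) (auto intro: integrable_component)
  then show ?thesis by (simp add: integrable_component prob_space)
qed

lemma surplus_conj_le:
  assumes "p \<in> prob_simplex"
  shows "surplus_conj P \<epsilon> p \<le> ereal (- (\<Sum>i\<in>UNIV. p $ i * (LINT \<omega>|P. \<epsilon> \<omega> $ i)))"
  unfolding surplus_conj_def
proof (rule SUP_least)
  fix u
  have "(\<Sum>i\<in>UNIV. p $ i * (u $ i + (LINT \<omega>|P. \<epsilon> \<omega> $ i))) \<le> (\<Sum>i\<in>UNIV. p $ i * surplus P \<epsilon> u)"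
    using assms by (intro sum_mono mult_left_mono surplus_ge) (auto simp: prob_simplex_def)
  also have "\<dots> = surplus P \<epsilon> u"
    using assms by (simp add: prob_simplex_def flip: sum_distrib_right)
  finally show "ereal (p \<bullet> u - surplus P \<epsilon> u)
      \<le> ereal (- (\<Sum>i\<in>UNIV. p $ i * (LINT \<omega>|P. \<epsilon> \<omega> $ i)))"
    by (simp add: inner_vec_sum distrib_left sum.distrib)
qed

lemma surplus_conj_ge: "ereal (- (LINT \<omega>|P. (MAX i. \<epsilon> \<omega> $ i))) \<le> surplus_conj P \<epsilon> p"
  unfolding surplus_conj_def by (rule SUP_upper2[of 0]) (auto simp: surplus_def)

lemma surplus_conj_finite:
  assumes "p \<in> prob_simplex"
  shows "surplus_conj P \<epsilon> p = ereal (real_of_ereal (surplus_conj P \<epsilon> p))"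
  using surplus_conj_le[OF assms] surplus_conj_ge[of p]
  by (cases "surplus_conj P \<epsilon> p") auto

text \<open>The prox-function at a vertex: the conjugate is at most the negated mean of one
  component there, and at least minus the surplus of the zero vector everywhere.\<close>

lemma prox_vertex_le_gap_D:
  assumes "p \<in> prob_simplex"
  shows "real_of_ereal (surplus_conj P \<epsilon> (axis i 1))
    - real_of_ereal (surplus_conj P \<epsilon> p) \<le> gap_D P \<epsilon>"
proof -
  have "(\<Sum>j\<in>UNIV. axis i 1 $ j * (LINT \<omega>|P. \<epsilon> \<omega> $ j)) = (LINT \<omega>|P. \<epsilon> \<omega> $ i)"
    by (simp add: axis_def if_distrib[of "\<lambda>c. c * _"] cong: if_cong)
  then have "ereal (real_of_ereal (surplus_conj P \<epsilon> (axis i 1))) \<le> ereal (- (LINT \<omega>|P. \<epsilon> \<omega> $ i))"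
    using surplus_conj_le[OF axis_in_prob_simplex, of i]
      surplus_conj_finite[OF axis_in_prob_simplex, of i] by simp
  moreover have "(MIN j. (LINT \<omega>|P. \<epsilon> \<omega> $ j)) \<le> (LINT \<omega>|P. \<epsilon> \<omega> $ i)"
    by (rule Min_le) auto
  moreover have "ereal (- (LINT \<omega>|P. (MAX i. \<epsilon> \<omega> $ i))) \<le> ereal (real_of_ereal (surplus_conj P \<epsilon> p))"
    using surplus_conj_ge[of p] surplus_conj_finite[OF assms] by simp
  ultimately show ?thesis unfolding gap_D_def ereal_less_eq by linarith
qed

end

section \<open>The consumption problem and its dual\<close>

lemma inner_vdiv_matrix:
  fixes Q :: "real ^ 'm::finite ^ 'n::finite"
  shows "vdiv (Q *v x) \<sigma> \<bullet> q = x \<bullet> (transpose Q *v vdiv q \<sigma>)"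
proof -
  have "vdiv (Q *v x) \<sigma> \<bullet> q = (Q *v x) \<bullet> vdiv q \<sigma>"
    by (simp add: inner_vec_sum vdiv_def)
  also have "\<dots> = x \<bullet> (transpose Q *v vdiv q \<sigma>)"
    by (metis dot_lmul_matrix inner_commute transpose_matrix_vector)
  finally show ?thesis .
qed

lemma weak_duality:
  fixes Q :: "real ^ 'm::finite ^ 'n::finite"
  assumes pi_pos: "\<forall>j. 0 < \<pi> $ j" and sigma_pos: "\<forall>i. 0 < \<sigma> $ i"
    and x: "x \<in> primal_feasible \<pi> w" and l: "l \<in> dual_feasible \<sigma>"
  shows "primal_obj Q \<sigma> x \<le> dual_obj Q \<pi> w l"
proof -
  let ?U = "primal_obj Q \<sigma> x" and ?mx = "MAX j. (transpose Q *v l) $ j / \<pi> $ j"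
  have "?U = ?U * (\<sigma> \<bullet> l)" using l by (simp add: dual_feasible_def)
  also have "\<dots> = (\<Sum>i\<in>UNIV. ?U * \<sigma> $ i * l $ i)"
    by (simp add: inner_vec_sum sum_distrib_left mult.assoc)
  also have "\<dots> \<le> (\<Sum>i\<in>UNIV. (Q *v x) $ i * l $ i)"
  proof (intro sum_mono mult_right_mono)
    fix i
    have "?U \<le> (Q *v x) $ i / \<sigma> $ i" unfolding primal_obj_def by (rule Min_le) auto
    then show "?U * \<sigma> $ i \<le> (Q *v x) $ i" using sigma_pos by (simp add: pos_le_divide_eq)
    show "0 \<le> l $ i" using l by (simp add: dual_feasible_def)
  qed
  also have "\<dots> = x \<bullet> (transpose Q *v l)"
    by (metis dot_lmul_matrix inner_commute inner_vec_sum transpose_matrix_vector)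
  also have "\<dots> \<le> (\<Sum>j\<in>UNIV. x $ j * (?mx * \<pi> $ j))"
    unfolding inner_vec_sum
  proof (intro sum_mono mult_left_mono)
    fix j
    have "(transpose Q *v l) $ j / \<pi> $ j \<le> ?mx" by (rule Max_ge) auto
    then show "(transpose Q *v l) $ j \<le> ?mx * \<pi> $ j"
      using pos_divide_le_eq[OF pi_pos[rule_format]] by blast
    show "0 \<le> x $ j" using x by (simp add: primal_feasible_def)
  qed
  also have "\<dots> = ?mx * (\<pi> \<bullet> x)"
    by (simp add: inner_vec_sum sum_distrib_right mult_ac)
  also have "\<dots> = dual_obj Q \<pi> w l"
    using x by (simp add: primal_feasible_def dual_obj_def mult.commute)
  finally show ?thesis .
qed

lemma dual_obj_average_le:
  fixes Q :: "real ^ 'm::finite ^ 'n::finite"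
  assumes "0 \<le> w"
  shows "dual_obj Q \<pi> w (average l k) \<le> average (\<lambda>t. dual_obj Q \<pi> w (l t)) k"
proof -
  let ?c = "1 / real (k + 1)"
  let ?mx = "\<lambda>t. MAX j. (transpose Q *v l t) $ j / \<pi> $ j"
  have le: "(transpose Q *v average l k) $ j / \<pi> $ j \<le> ?c * (\<Sum>t\<le>k. ?mx t)" for j
  proof -
    have "(transpose Q *v average l k) $ j / \<pi> $ j = ?c * (\<Sum>t\<le>k. (transpose Q *v l t) $ j / \<pi> $ j)"
      by (simp add: average_def matrix_vector_mult_scaleR vec.sum sum_divide_distrib mult.commute)
    also have "\<dots> \<le> ?c * (\<Sum>t\<le>k. ?mx t)"
      by (intro mult_left_mono sum_mono Max_ge) auto
    finally show ?thesis .
  qed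
  have "(MAX j. (transpose Q *v average l k) $ j / \<pi> $ j) \<le> ?c * (\<Sum>t\<le>k. ?mx t)"
    by (rule Max.boundedI) (blast intro: finite le)+
  then have "w * (MAX j. (transpose Q *v average l k) $ j / \<pi> $ j) \<le> w * (?c * (\<Sum>t\<le>k. ?mx t))"
    using \<open>0 \<le> w\<close> by (rule mult_left_mono)
  also have "\<dots> = average (\<lambda>t. dual_obj Q \<pi> w (l t)) k"
    by (simp add: average_def dual_obj_def flip: sum_distrib_left)
  finally show ?thesis by (simp add: dual_obj_def)
qed

lemma convex_primal_feasible: "convex (primal_feasible \<pi> w)"
  unfolding convex_def primal_feasible_def
  by (auto simp: inner_right_distrib simp flip: distrib_right)

lemma convex_dual_feasible: "convex (dual_feasible \<sigma>)"
  unfolding convex_def dual_feasible_def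
  by (auto simp: inner_right_distrib)

lemma vdiv_matrix_average:
  "average (\<lambda>l. vdiv (Q *v x l) \<sigma>) k = vdiv (Q *v average x k) \<sigma>"
  by (simp add: average_def vec_eq_iff vdiv_def matrix_vector_mult_scaleR vec.sum
      sum_divide_distrib mult.commute)

lemma vdiv_dual_feasible:
  assumes "\<forall>i. 0 < \<sigma> $ i" "p \<in> prob_simplex"
  shows "vdiv p \<sigma> \<in> dual_feasible \<sigma>"
proof -
  have "\<sigma> $ i * (p $ i / \<sigma> $ i) = p $ i" for i
    using assms(1) by (simp add: less_imp_neq[symmetric])
  then show ?thesis
    using assms by (auto simp: dual_feasible_def prob_simplex_def vdiv_def inner_vec_sum less_imp_le)
qed

text \<open>Spending the whole budget \<open>w\<close> on the best goods yields a subgradient of the dual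
  objective as a function of \<open>p\<close>.  As this function is positively homogeneous, the pairing of the subgradient with
  \<open>p\<close> is the value of the objective.\<close>

lemma inner_best_demand:
  fixes Q :: "real ^ 'm::finite ^ 'n::finite"
  assumes y: "(\<Sum>j\<in>UNIV. y $ j) = 1" "\<And>j. j \<notin> best_goods Q \<pi> (vdiv p \<sigma>) \<Longrightarrow> y $ j = 0"
  shows "vdiv (Q *v (w *\<^sub>R vdiv y \<pi>)) \<sigma> \<bullet> p = dual_obj Q \<pi> w (vdiv p \<sigma>)"
proof -
  let ?mx = "MAX j. (transpose Q *v vdiv p \<sigma>) $ j / \<pi> $ j"
  have "y $ j * ((transpose Q *v vdiv p \<sigma>) $ j / \<pi> $ j) = y $ j * ?mx" for j
    using y(2)[of j] by (cases "j \<in> best_goods Q \<pi> (vdiv p \<sigma>)") (auto simp: best_goods_def)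
  then have "w * (\<Sum>j\<in>UNIV. y $ j * ((transpose Q *v vdiv p \<sigma>) $ j / \<pi> $ j)) = w * ?mx"
    using y(1) by (simp flip: sum_distrib_right)
  then show ?thesis
    unfolding inner_vdiv_matrix
    by (simp add: dual_obj_def inner_vec_sum vdiv_def sum_distrib_left mult.assoc)
qed

lemma abs_vdiv_demand_le_gap_M:
  fixes Q :: "real ^ 'm::finite ^ 'n::finite"
  assumes pi_pos: "\<forall>j. 0 < \<pi> $ j" and sigma_pos: "\<forall>i. 0 < \<sigma> $ i" and "0 \<le> w"
    and y: "\<forall>j. 0 \<le> y $ j" "(\<Sum>j\<in>UNIV. y $ j) = 1"
  shows "\<bar>vdiv (Q *v (w *\<^sub>R vdiv y \<pi>)) \<sigma> $ i\<bar> \<le> gap_M Q \<pi> \<sigma> w"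
proof -
  let ?mx = "MAX (i, j). \<bar>Q $ i $ j\<bar> / (\<sigma> $ i * \<pi> $ j)"
  have le: "\<bar>Q $ i $ j\<bar> / (\<sigma> $ i * \<pi> $ j) \<le> ?mx" for j
    by (rule Max_ge) (auto intro!: image_eqI[of _ _ "(i, j)"])
  have "vdiv (Q *v (w *\<^sub>R vdiv y \<pi>)) \<sigma> $ i = w * (\<Sum>j\<in>UNIV. y $ j * (Q $ i $ j / (\<sigma> $ i * \<pi> $ j)))"
    by (simp add: vdiv_def matrix_vector_mult_def sum_distrib_left sum_divide_distrib field_simps)
  then have "\<bar>vdiv (Q *v (w *\<^sub>R vdiv y \<pi>)) \<sigma> $ i\<bar>
      = w * \<bar>\<Sum>j\<in>UNIV. y $ j * (Q $ i $ j / (\<sigma> $ i * \<pi> $ j))\<bar>"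
    using \<open>0 \<le> w\<close> by (simp add: abs_mult)
  also have "\<dots> \<le> w * (\<Sum>j\<in>UNIV. y $ j * ?mx)"
  proof (intro mult_left_mono order_trans[OF sum_abs] sum_mono \<open>0 \<le> w\<close>)
    fix j
    have "\<bar>y $ j * (Q $ i $ j / (\<sigma> $ i * \<pi> $ j))\<bar> = y $ j * (\<bar>Q $ i $ j\<bar> / (\<sigma> $ i * \<pi> $ j))"
      using y pi_pos sigma_pos by (simp add: abs_mult abs_of_pos)
    also have "\<dots> \<le> y $ j * ?mx" using y le by (intro mult_left_mono) auto
    finally show "\<bar>y $ j * (Q $ i $ j / (\<sigma> $ i * \<pi> $ j))\<bar> \<le> y $ j * ?mx" .
  qed
  also have "\<dots> = gap_M Q \<pi> \<sigma> w" using y by (simp add: gap_M_def flip: sum_distrib_right)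
  finally show ?thesis .
qed

lemma demand_primal_feasible:
  assumes "\<forall>j. 0 < \<pi> $ j" "0 \<le> w" "\<forall>j. 0 \<le> y $ j" "(\<Sum>j\<in>UNIV. y $ j) = 1"
  shows "w *\<^sub>R vdiv y \<pi> \<in> primal_feasible \<pi> w"
proof -
  have "\<pi> $ j * (w * (y $ j / \<pi> $ j)) = w * y $ j" for j
    using assms(1)[rule_format, of j] by simp
  then show ?thesis
    using assms by (auto simp: primal_feasible_def vdiv_def inner_vec_sum less_imp_le
        simp flip: sum_distrib_left)
qed

section \<open>The duality gap\<close>

theorem theorem5:
  fixes Q :: "real ^ 'm::finite ^ 'n::finite"
    and \<pi> :: "real ^ 'm" and \<sigma> :: "real ^ 'n" and w \<beta> :: real
    and P :: "'a measure" and \<epsilon> :: "'a \<Rightarrow> real ^ 'n"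
    and p lam :: "nat \<Rightarrow> real ^ 'n" and x y :: "nat \<Rightarrow> real ^ 'm"
  assumes pi_pos: "\<forall>j. 0 < \<pi> $ j"
    and sigma_pos: "\<forall>i. 0 < \<sigma> $ i"
    and w_pos: "0 < w"
    and standing: "\<exists>z. (\<forall>j. 0 \<le> z $ j) \<and> \<pi> \<bullet> z \<le> w \<and> 0 < primal_obj Q \<sigma> z"
    and rum: "random_utility P \<epsilon>"
    and beta_pos: "0 < \<beta>"
    and strongly_convex: "l1_strongly_convex_on prob_simplex \<beta> (surplus_conj P \<epsilon>)"
    and cycle: "consumption_cycle (surplus_conj P \<epsilon>) Q \<pi> \<sigma> w p lam y x"
  shows "(\<lambda>k. dual_obj Q \<pi> w (average lam k) - primal_obj Q \<sigma> (average x k))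
           \<in> O(\<lambda>k. 1 / sqrt (real (k + 1)))
       \<and> (\<forall>k. average x k \<in> primal_feasible \<pi> w
            \<and> average lam k \<in> dual_feasible \<sigma>
            \<and> 0 \<le> dual_obj Q \<pi> w (average lam k) - primal_obj Q \<sigma> (average x k)
            \<and> dual_obj Q \<pi> w (average lam k) - primal_obj Q \<sigma> (average x k)
                \<le> (gap_D P \<epsilon> + (gap_M Q \<pi> \<sigma> w)\<^sup>2 / \<beta>) * (1 / sqrt (real (k + 1))))"
proof -
  define F where "F = surplus_conj P \<epsilon>"
  define f where "f q = real_of_ereal (F q)" for q
  define g where "g l = vdiv (Q *v x l) \<sigma>" for l
  define C where "C = gap_D P \<epsilon> + (gap_M Q \<pi> \<sigma> w)\<^sup>2 / \<beta>"
  have F_eq: "F q = ereal (f q)" if "q \<in> prob_simplex" for q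
    using surplus_conj_finite[OF rum that] by (simp add: F_def f_def)
  have cyc: "is_arg_min F (\<lambda>q. q \<in> prob_simplex) (p 0)"
    and lam: "lam k = vdiv (p k) \<sigma>"
    and y: "\<forall>j. 0 \<le> y k $ j" "(\<Sum>j\<in>UNIV. y k $ j) = 1"
      "\<And>j. j \<notin> best_goods Q \<pi> (lam k) \<Longrightarrow> y k $ j = 0"
    and x: "x k = w *\<^sub>R vdiv (y k) \<pi>"
    and cycS: "is_arg_min (\<lambda>q. ereal (average g k \<bullet> q)
                   + (F q - F (p 0)) / ereal (sqrt (real (k + 1)))) (\<lambda>q. q \<in> prob_simplex) (p (Suc k))"
    for k
    using cycle unfolding consumption_cycle_def F_def g_def by blast+
  have mem: "p k \<in> prob_simplex" for k
    using cyc cycS by (cases k) (auto simp: is_arg_min_def)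
  have w: "0 \<le> w" using w_pos by simp
  have feas_x: "average x k \<in> primal_feasible \<pi> w" for k
    by (intro average_mem_convex convex_primal_feasible)
      (use x y demand_primal_feasible[OF pi_pos w] in auto)
  have feas_l: "average lam k \<in> dual_feasible \<sigma>" for k
    by (intro average_mem_convex convex_dual_feasible)
      (use lam vdiv_dual_feasible[OF sigma_pos mem] in auto)
  have gap_nonneg: "0 \<le> dual_obj Q \<pi> w (average lam k) - primal_obj Q \<sigma> (average x k)" for k
    using weak_duality[OF pi_pos sigma_pos feas_x feas_l] by simp
  have sc: "l1_strongly_convex_on prob_simplex \<beta> (\<lambda>q. ereal (f q))"
    unfolding l1_strongly_convex_on_def
  proof (intro ballI)
    fix u v :: "real ^ 'n" and \<alpha> :: real
    assume u: "u \<in> prob_simplex" and v: "v \<in> prob_simplex" and a: "\<alpha> \<in> {0..1}"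
    have "\<alpha> *\<^sub>R u + (1 - \<alpha>) *\<^sub>R v \<in> prob_simplex"
      using u v a by (intro convexD[OF convex_prob_simplex]) auto
    then show "ereal (f (\<alpha> *\<^sub>R u + (1 - \<alpha>) *\<^sub>R v))
          \<le> ereal \<alpha> * ereal (f u) + ereal (1 - \<alpha>) * ereal (f v)
             - ereal (\<beta> / 2 * \<alpha> * (1 - \<alpha>) * (l1norm (u - v))\<^sup>2)"
      using strongly_convex u v a unfolding l1_strongly_convex_on_def F_def[symmetric]
      by (metis F_eq)
  qed
  have min0: "f (p 0) \<le> f q" if "q \<in> prob_simplex" for q
    using cyc that F_eq[OF that] F_eq[OF mem[of 0]] by (auto simp: is_arg_min_def not_less)
  have min: "average g k \<bullet> p (Suc k) + (f (p (Suc k)) - f (p 0)) / sqrt (real (k + 1))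
      \<le> average g k \<bullet> q + (f q - f (p 0)) / sqrt (real (k + 1))" if "q \<in> prob_simplex" for k q
  proof -
    have real: "ereal (average g k \<bullet> u) + (F u - F (p 0)) / ereal (sqrt (real (k + 1)))
        = ereal (average g k \<bullet> u + (f u - f (p 0)) / sqrt (real (k + 1)))"
      if "u \<in> prob_simplex" for u
      using F_eq[OF that] F_eq[OF mem[of 0]] by simp
    show ?thesis
      using cycS[of k] that real[OF that] real[OF mem[of "Suc k"]]
      by (auto simp: is_arg_min_def not_less)
  qed
  have bound: "\<bar>g k $ i\<bar> \<le> gap_M Q \<pi> \<sigma> w" for k i
    unfolding g_def x by (rule abs_vdiv_demand_le_gap_M[OF pi_pos sigma_pos w y(1,2)])
  have gap_le: "dual_obj Q \<pi> w (average lam k) - primal_obj Q \<sigma> (average x k)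
      \<le> C * (1 / sqrt (real (k + 1)))" for k
  proof -
    \<comment> \<open>Compare with the vertex of the simplex at which \<open>average g k\<close> is smallest.\<close>
    have "primal_obj Q \<sigma> (average x k) \<in> range (\<lambda>i. (Q *v average x k) $ i / \<sigma> $ i)"
      unfolding primal_obj_def by (rule Min_in) auto
    then obtain i where i: "primal_obj Q \<sigma> (average x k) = (Q *v average x k) $ i / \<sigma> $ i"
      by blast
    have vertex: "average g k \<bullet> axis i 1 = primal_obj Q \<sigma> (average x k)"
      unfolding g_def vdiv_matrix_average i by (simp add: inner_axis vdiv_def)
    have dual: "g l \<bullet> p l = dual_obj Q \<pi> w (lam l)" for l
      using inner_best_demand[OF y(2)[of l], where Q = Q and p = "p l" and \<sigma> = \<sigma>
          and w = w and \<pi> = \<pi>] y(3)[of _ l]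
      by (simp add: g_def x lam)
    have "dual_obj Q \<pi> w (average lam k) \<le> average (\<lambda>l. g l \<bullet> p l) k"
      unfolding dual by (rule dual_obj_average_le[OF w])
    also have "\<dots> \<le> average g k \<bullet> axis i 1
        + (f (axis i 1) - f (p 0) + (gap_M Q \<pi> \<sigma> w)\<^sup>2 / \<beta>) * (1 / sqrt (real (k + 1)))"
      by (rule dual_averaging_sqrt_rate[OF convex_prob_simplex beta_pos sc mem min0 min bound
            axis_in_prob_simplex])
    also have "\<dots> \<le> average g k \<bullet> axis i 1 + C * (1 / sqrt (real (k + 1)))"
      using prox_vertex_le_gap_D[OF rum mem[of 0], of i]
      by (intro add_left_mono mult_right_mono) (auto simp: C_def f_def F_def)
    finally show ?thesis unfolding vertex by simp
  qed
  have "(\<lambda>k. dual_obj Q \<pi> w (average lam k) - primal_obj Q \<sigma> (average x k))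
      \<in> O(\<lambda>k. 1 / sqrt (real (k + 1)))"
  proof (rule bigoI[of _ C], rule always_eventually, rule allI)
    fix k
    show "norm (dual_obj Q \<pi> w (average lam k) - primal_obj Q \<sigma> (average x k))
        \<le> C * norm (1 / sqrt (real (k + 1)))"
      using gap_nonneg[of k] gap_le[of k] by simp
  qed
  then show ?thesis
    using feas_x feas_l gap_nonneg gap_le unfolding C_def by blast
qed

end
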